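(* Let $n\ge 2$, $m\ge1$ and $1\le r<n$ be integers. Then $$\mathcal{B}(n,r,m)\le\bar{\mathcal{B}}(n,r,m)\le\frac{(n-r+1)(n-r)}{2}+1.$$ Moreover, if $m\le n-r$, then $$n-r+1+\frac{m(m-1)}{2}\le\mathcal{B}(n,r,m)\le\bar{\mathcal{B}}(n,r,m).$$ Consequently, if $m\ge n-r$, then $\mathcal{B}(n,r,m)=\bar{\mathcal{B}}(n,r,m)=\frac{(n-r+1)(n-r)}{2}+1$.
   Context: Consider switched linear control systems $x_k=A_{i_k}x_{k-1}+B_{i_k}u_k$, $k\ge1$, on $\mathbb{R}^n$ with $m$ modes $(A_i,B_i)$, $i\in\Sigma=\{1,\dots,m\}$, $A_i$ real $n\times n$ and $B_i$ real with $n$ rows. For a word $\pi=i_1\cdots i_k$ over $\Sigma$, $\mathcal{R}(\pi)=\mathrm{Im}(A_{i_k}\cdots A_{i_2}B_{i_1},\dots,A_{i_k}B_{i_{k-1}},B_{i_k})$ is the set of states reachable at time $k$ from $x_0=0$ with switching sequence $i_1,\dots,i_k$; $\pi$ is a controllable sequence if $\mathcal{R}(\pi)=\mathbb{R}^n$, and the system is controllable if the union of all $\mathcal{R}(\pi)$ is $\mathbb{R}^n$. $\mathcal{B}(n,r,m)$ denotes the maximum, over all controllable such systems on $\mathbb{R}^n$ with $m$ modes in which every $A_i$ is invertible and every $B_i$ has rank exactly $r$, of the minimal length of a controllable sequence. $\bar{\mathcal{B}}(n,r,m)$ is defined in the same way but maximizing over systems in which every $A_i$ is invertible and every $B_i$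 has rank at least $r$. *)

theory Defs
  imports "Jordan_Normal_Form.DL_Rank" "HOL-Library.Extended_Nat"
begin

text \<open>A switched linear control system on R^n with m modes is given by
  A, B :: nat => real mat; the modes are indexed by 0..<m (mode i of the
  paper is index i-1 here).  A switching word i_1 ... i_k is a list
  [i_1, ..., i_k] (time order) with entries < m.\<close>

text \<open>States reachable from x_0 = 0, with the word given in REVERSE time order.\<close>
fun reach_rev :: "nat \<Rightarrow> (nat \<Rightarrow> real mat) \<Rightarrow> (nat \<Rightarrow> real mat) \<Rightarrow> nat list \<Rightarrow> real vec set" where
  "reach_rev n A B [] = {0\<^sub>v n}"
| "reach_rev n A B (i # \<rho>) =
     {A i *\<^sub>v x + B i *\<^sub>v u | x u. x \<in> reach_rev n A B \<rho> \<and> u \<in> carrier_vec (dim_col (B i))}"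

definition reach :: "nat \<Rightarrow> (nat \<Rightarrow> real mat) \<Rightarrow> (nat \<Rightarrow> real mat) \<Rightarrow> nat list \<Rightarrow> real vec set" where
  "reach n A B \<pi> = reach_rev n A B (rev \<pi>)"

definition controllable_seq :: "nat \<Rightarrow> (nat \<Rightarrow> real mat) \<Rightarrow> (nat \<Rightarrow> real mat) \<Rightarrow> nat list \<Rightarrow> bool" where
  "controllable_seq n A B \<pi> \<longleftrightarrow> reach n A B \<pi> = carrier_vec n"

definition controllable_sys :: "nat \<Rightarrow> nat \<Rightarrow> (nat \<Rightarrow> real mat) \<Rightarrow> (nat \<Rightarrow> real mat) \<Rightarrow> bool" where
  "controllable_sys n m A B \<longleftrightarrow> (\<Union>\<pi>\<in>{\<pi>. set \<pi> \<subseteq> {..<m}}. reach n A B \<pi>) = carrier_vec n"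

definition min_ctrl_len :: "nat \<Rightarrow> nat \<Rightarrow> (nat \<Rightarrow> real mat) \<Rightarrow> (nat \<Rightarrow> real mat) \<Rightarrow> nat" where
  "min_ctrl_len n m A B =
     (LEAST k. \<exists>\<pi>. set \<pi> \<subseteq> {..<m} \<and> length \<pi> = k \<and> controllable_seq n A B \<pi>)"

definition admissible :: "nat \<Rightarrow> nat \<Rightarrow> (nat \<Rightarrow> bool) \<Rightarrow> (nat \<Rightarrow> real mat) \<Rightarrow> (nat \<Rightarrow> real mat) \<Rightarrow> bool" where
  "admissible n m P A B \<longleftrightarrow>
     (\<forall>i<m. A i \<in> carrier_mat n n \<and> invertible_mat (A i) \<and>
            dim_row (B i) = n \<and> P (vec_space.rank n (B i)))"

definition calB :: "nat \<Rightarrow> nat \<Rightarrow> nat \<Rightarrow> enat" where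
  "calB n r m = (SUP AB \<in> {(A, B). admissible n m (\<lambda>k. k = r) A B \<and> controllable_sys n m A B}.
                   enat (min_ctrl_len n m (fst AB) (snd AB)))"

definition calBbar :: "nat \<Rightarrow> nat \<Rightarrow> nat \<Rightarrow> enat" where
  "calBbar n r m = (SUP AB \<in> {(A, B). admissible n m (\<lambda>k. k \<ge> r) A B \<and> controllable_sys n m A B}.
                   enat (min_ctrl_len n m (fst AB) (snd AB)))"

end

theory Submission
  imports Defs "HOL-Combinatorics.Permutations"
begin

text \<open>Upper bound: let \<open>\<pi>\<close> reach a proper subspace of dimension \<open>d\<close>. Prefixing \<open>\<pi>\<close> by a word \<open>\<tau>\<close>
  enlarges it unless \<open>R \<tau>\<close> lies in the preimage of \<open>R \<pi>\<close> under the flow of \<open>\<pi>\<close>, which has dimension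
  at most \<open>d\<close>. The states that stay in a proper subspace \<open>U\<close> under all words of length at most \<open>j\<close> form
  a chain decreasing strictly in \<open>j\<close> until it no longer contains all the inputs, as a stationary
  member would be invariant. Hence a prefix of length at most \<open>d - r + 1\<close> suffices, and summing over
  \<open>d = r, \<dots>, n - 1\<close> gives the bound. When all inputs have the same range of dimension \<open>r\<close>, the
  chain argument loses one step, which is regained by keeping the first letter of the word in front.

  Lower bound: all inputs act on the first \<open>r\<close> coordinates. One mode cycles a final segment of the
  coordinates, the others are the adjacent transpositions that lead from coordinate \<open>r\<close> to it. Weights
  on the coordinates make every step raise the total weight of the reachable coordinates by at most
  one.\<close>

section \<open>Dimension of sets of vectors\<close>

text \<open>Taking the largest size of an independent subset gives the dimension of the span and
  makes sense for sets that are not subspaces, such as the union of the input ranges.\<close>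

definition (in vec_space) sdim :: "'a vec set \<Rightarrow> nat" where
  "sdim W = Max (card ` {S. S \<subseteq> W \<and> S \<subseteq> carrier_vec n \<and> lin_indpt S})"

context vec_space
begin

lemma submodule_vecI:
  assumes "W \<subseteq> carrier_vec n" "0\<^sub>v n \<in> W"
    and "\<And>x y. x \<in> W \<Longrightarrow> y \<in> W \<Longrightarrow> x + y \<in> W"
    and "\<And>c x. x \<in> W \<Longrightarrow> c \<cdot>\<^sub>v x \<in> W"
  shows "submodule class_ring W V"
  using assms vec_module by (simp add: submodule_def)

lemma submodule_vecD:
  assumes "submodule class_ring W V"
  shows "W \<subseteq> carrier_vec n" "0\<^sub>v n \<in> W"
    and "\<And>x y. x \<in> W \<Longrightarrow> y \<in> W \<Longrightarrow> x + y \<in> W"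
    and "\<And>c x. x \<in> W \<Longrightarrow> c \<cdot>\<^sub>v x \<in> W"
  using assms by (simp_all add: submodule_def class_field_def)

lemma finite_card_lin_indpt:
  "finite (card ` {S. S \<subseteq> W \<and> S \<subseteq> carrier_vec n \<and> lin_indpt S})"
  by (rule finite_subset[of _ "{..dim}"]) (use li_le_dim(2)[OF fin_dim] in auto)

lemma card_le_sdim:
  "S \<subseteq> W \<Longrightarrow> S \<subseteq> carrier_vec n \<Longrightarrow> lin_indpt S \<Longrightarrow> card S \<le> sdim W"
  unfolding sdim_def by (rule Max_ge[OF finite_card_lin_indpt]) auto

lemma sdim_witness:
  obtains S where "S \<subseteq> W" "S \<subseteq> carrier_vec n" "lin_indpt S" "finite S" "card S = sdim W"
proof -
  have "lin_indpt {}" by (simp add: lin_dep_def)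
  then have "sdim W \<in> card ` {S. S \<subseteq> W \<and> S \<subseteq> carrier_vec n \<and> lin_indpt S}"
    unfolding sdim_def by (intro Max_in[OF finite_card_lin_indpt]) blast
  then show thesis using that li_le_dim(1)[OF fin_dim] by auto
qed

lemma sdim_mono: "W \<subseteq> W' \<Longrightarrow> sdim W \<le> sdim W'"
  by (metis sdim_witness card_le_sdim subset_trans)

text \<open>A vector of \<open>W'\<close> outside the subspace \<open>W\<close> is outside the span
  of a largest independent subset of \<open>W\<close>, so it can be added to that subset.
  \<open>W'\<close> may be any set of vectors; below it is also a union of input ranges.\<close>

lemma sdim_strict_mono:
  assumes W: "submodule class_ring W V" and sub: "W \<subset> W'" and W': "W' \<subseteq> carrier_vec n"
  shows "sdim W < sdim W'"
proof -
  obtain S where S: "S \<subseteq> W" "S \<subseteq> carrier_vec n" "lin_indpt S" "finite S" "card S = sdim W"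
    by (rule sdim_witness)
  obtain v where v: "v \<in> W'" "v \<notin> W" using sub by auto
  have "v \<notin> span S" using span_is_subset[OF S(1) W] v by auto
  moreover have "v \<notin> S" "v \<in> carrier_vec n" using v S W' by auto
  ultimately have "lin_indpt (S \<union> {v})" using lin_dep_iff_in_span[of S v] S by simp
  then have "card (S \<union> {v}) \<le> sdim W'"
    using S sub v W' by (intro card_le_sdim) auto
  then show ?thesis using S \<open>v \<notin> S\<close> by simp
qed

lemma sdim_carrier: "sdim (carrier_vec n) = n"
proof (rule antisym)
  show "sdim (carrier_vec n) \<le> n"
    using li_le_dim(2)[OF fin_dim] dim_is_n by (metis sdim_witness cV)
  show "n \<le> sdim (carrier_vec n)"
    using card_le_sdim[of "set (unit_vecs n)" "carrier_vec n"] unit_vecs_basis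
      distinct_card[OF unit_vecs_distinct] unfolding basis_def by (metis unit_vecs_length cV)
qed

text \<open>A linear relation among the images is \<open>A\<close> applied to the relation with the
  same coefficients among the elements of \<open>S\<close>, so injectivity pulls it back to
  \<open>S\<close>.\<close>

lemma lin_indpt_image:
  assumes A: "A \<in> carrier_mat n n" and inj: "inj_on ((*\<^sub>v) A) (carrier_vec n)"
    and S: "S \<subseteq> carrier_vec n" "lin_indpt S" "finite S"
  shows "lin_indpt ((*\<^sub>v) A ` S)"
proof -
  have "mod_hom class_ring V V ((*\<^sub>v) A)"
    using A vec_module
    by (intro mod_hom.intro mod_hom_axioms.intro)
       (auto simp: LinearCombinations.module_hom_def mult_add_distrib_mat_vec mult_mat_vec)
  then have lin: "linear_map class_ring V V ((*\<^sub>v) A)"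
    using vec_vs by (intro linear_map.intro)
  show ?thesis
  proof (rule finite_lin_indpt2)
    show "(*\<^sub>v) A ` S \<subseteq> carrier_vec n" using A S by auto
    fix a :: "'a vec \<Rightarrow> 'a" assume "lincomb a ((*\<^sub>v) A ` S) = 0\<^sub>v n"
    moreover have "A *\<^sub>v 0\<^sub>v n = 0\<^sub>v n" using A by (intro eq_vecI) auto
    ultimately have "A *\<^sub>v lincomb (a \<circ> (*\<^sub>v) A) S = A *\<^sub>v 0\<^sub>v n"
      using linear_map.lincomb_linear_image[OF lin, of S a] inj S A by (simp add: class_ring_simps)
    then have "lincomb (a \<circ> (*\<^sub>v) A) S = 0\<^sub>v n"
      using inj S lincomb_closed[of S] by (auto dest!: inj_onD)
    then have "\<forall>v\<in>S. (a \<circ> (*\<^sub>v) A) v = 0"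
      using not_lindepD[OF S(2,3) subset_refl, of "a \<circ> (*\<^sub>v) A"] by auto
    then show "\<forall>v\<in>(*\<^sub>v) A ` S. a v = 0" by simp
  qed (use S in simp)
qed

lemma invertible_mat_bij:
  assumes A: "A \<in> carrier_mat n n" and inv: "invertible_mat A"
  shows "bij_betw ((*\<^sub>v) A) (carrier_vec n) (carrier_vec n)"
proof -
  obtain B where B: "inverts_mat A B" "inverts_mat B A" using inv unfolding invertible_mat_def by auto
  then have "B \<in> carrier_mat n n"
    using A by (metis inverts_mat_def carrier_matD carrier_matI index_mult_mat(2,3) index_one_mat(2,3))
  then show ?thesis
    using A B by (intro bij_betw_byWitness[of _ "(*\<^sub>v) B"])
      (auto simp: inverts_mat_def simp flip: assoc_mult_mat_vec)
qed

text \<open>\<open>A\<close> carries an independent subset of the preimage to an independent subset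
  of \<open>W\<close> of the same size.\<close>

lemma sdim_preimage_le:
  assumes A: "A \<in> carrier_mat n n" and inv: "invertible_mat A" 
  shows "sdim {x \<in> carrier_vec n. A *\<^sub>v x \<in> W} \<le> sdim W"
proof -
  let ?U = "{x \<in> carrier_vec n. A *\<^sub>v x \<in> W}"
  have inj: "inj_on ((*\<^sub>v) A) (carrier_vec n)"
    using invertible_mat_bij[OF A inv] by (rule bij_betw_imp_inj_on)
  obtain S where S: "S \<subseteq> ?U" "S \<subseteq> carrier_vec n" "lin_indpt S" "finite S" "card S = sdim ?U"
    by (rule sdim_witness)
  have "card S = card ((*\<^sub>v) A ` S)"
    using card_image[OF inj_on_subset[OF inj S(2)]] by simp
  also have "\<dots> \<le> sdim W"
    using S A by (intro card_le_sdim lin_indpt_image[OF A inj]) auto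
  finally show ?thesis using S by simp
qed

text \<open>The rank is the size of a maximal independent set of columns, and each column is the
  image of a unit vector. This turns the rank condition on the inputs into a bound on
  \<open>sdim\<close>.\<close>

lemma rank_le_sdim_range:
  assumes A: "A \<in> carrier_mat n k"
  shows "rank A \<le> sdim {A *\<^sub>v u | u. u \<in> carrier_vec k}"
proof -
  let ?P = "\<lambda>T. T \<subseteq> set (cols A) \<and> lin_indpt T"
  have "lin_indpt {}" by (simp add: lin_dep_def)
  then obtain S where S: "maximal S ?P"
    using maximal_exists_superset[of "set (cols A)" ?P "{}"] by auto
  have "set (cols A) \<subseteq> {A *\<^sub>v u | u. u \<in> carrier_vec k}"
  proof
    fix v assume "v \<in> set (cols A)"
    then obtain j where j: "j < k" "v = col A j" using A by (auto simp: cols_def)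
    then have "v = A *\<^sub>v unit_vec k j" using A by (intro eq_vecI) auto
    then show "v \<in> {A *\<^sub>v u | u. u \<in> carrier_vec k}" by auto
  qed
  then show ?thesis
    using S cols_dim[of A] A unfolding rank_card_indpt[OF A S]
    by (intro card_le_sdim) (auto simp: maximal_def)
qed

end

section \<open>Reachable subspaces\<close>

locale switched_system = vec_space "TYPE(real)" n for n :: nat +
  fixes m :: nat and A B :: "nat \<Rightarrow> real mat"
  assumes A_carrier: "\<And>i. i < m \<Longrightarrow> A i \<in> carrier_mat n n"
    and A_invertible: "\<And>i. i < m \<Longrightarrow> invertible_mat (A i)"
    and dim_row_B: "\<And>i. i < m \<Longrightarrow> dim_row (B i) = n"
begin

abbreviation word :: "nat list \<Rightarrow> bool" where
  "word \<pi> \<equiv> set \<pi> \<subseteq> {..<m}"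

abbreviation R :: "nat list \<Rightarrow> real vec set" where
  "R \<pi> \<equiv> reach n A B \<pi>"

definition input_range :: "nat \<Rightarrow> real vec set" where
  "input_range i = {B i *\<^sub>v u | u. u \<in> carrier_vec (dim_col (B i))}"

definition flow :: "nat list \<Rightarrow> real vec \<Rightarrow> real vec" where
  "flow \<sigma> x = fold (\<lambda>i. (*\<^sub>v) (A i)) \<sigma> x"

definition invariant :: "real vec set \<Rightarrow> bool" where
  "invariant X \<longleftrightarrow> submodule class_ring X V \<and> (\<forall>i<m. \<forall>x\<in>X. A i *\<^sub>v x \<in> X)"

lemma B_carrier: "i < m \<Longrightarrow> B i \<in> carrier_mat n (dim_col (B i))"
  using dim_row_B by auto

section \<open>Evolution with zero input\<close>

lemma flow_Nil [simp]: "flow [] x = x"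
  and flow_Cons [simp]: "flow (i # \<sigma>) x = flow \<sigma> (A i *\<^sub>v x)"
  and flow_append: "flow (\<sigma> @ \<tau>) x = flow \<tau> (flow \<sigma> x)"
  by (simp_all add: flow_def)

lemma A_mult_carrier: "i < m \<Longrightarrow> x \<in> carrier_vec n \<Longrightarrow> A i *\<^sub>v x \<in> carrier_vec n"
  by (rule mult_mat_vec_carrier[OF A_carrier])

lemma flow_carrier: "word \<sigma> \<Longrightarrow> x \<in> carrier_vec n \<Longrightarrow> flow \<sigma> x \<in> carrier_vec n"
  by (induction \<sigma> arbitrary: x) (auto simp: A_mult_carrier)

lemma flow_add:
  "word \<sigma> \<Longrightarrow> x \<in> carrier_vec n \<Longrightarrow> y \<in> carrier_vec n \<Longrightarrow> flow \<sigma> (x + y) = flow \<sigma> x + flow \<sigma> y"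
  by (induction \<sigma> arbitrary: x y)
    (auto simp: A_mult_carrier mult_add_distrib_mat_vec[OF A_carrier])

lemma flow_smult:
  "word \<sigma> \<Longrightarrow> x \<in> carrier_vec n \<Longrightarrow> flow \<sigma> (c \<cdot>\<^sub>v x) = c \<cdot>\<^sub>v flow \<sigma> x"
  by (induction \<sigma> arbitrary: x) (auto simp: A_mult_carrier mult_mat_vec[OF A_carrier])

lemma flow_zero: "word \<sigma> \<Longrightarrow> flow \<sigma> (0\<^sub>v n) = 0\<^sub>v n"
  using flow_smult[of \<sigma> "0\<^sub>v n" 0] flow_carrier[of \<sigma> "0\<^sub>v n"] by auto

lemma flow_surj: "word \<sigma> \<Longrightarrow> flow \<sigma> ` carrier_vec n = carrier_vec n"
proof (induction \<sigma>)
  case (Cons i \<sigma>)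
  have "flow (i # \<sigma>) ` carrier_vec n = flow \<sigma> ` ((*\<^sub>v) (A i) ` carrier_vec n)"
    by (simp add: image_image)
  also have "(*\<^sub>v) (A i) ` carrier_vec n = carrier_vec n"
    using invertible_mat_bij[OF A_carrier A_invertible, of i] Cons.prems
    by (auto simp: bij_betw_def)
  finally show ?case using Cons by simp
qed simp

definition flow_preimage :: "nat list \<Rightarrow> real vec set \<Rightarrow> real vec set" where
  "flow_preimage \<sigma> W = {x \<in> carrier_vec n. flow \<sigma> x \<in> W}"

lemma flow_preimage_submodule:
  assumes "word \<sigma>" "submodule class_ring W V"
  shows "submodule class_ring (flow_preimage \<sigma> W) V"
  using submodule_vecD[OF assms(2)] assms(1)
  by (intro submodule_vecI) (auto simp: flow_preimage_def flow_add flow_smult flow_zero)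

lemma flow_preimage_proper:
  assumes "word \<sigma>" "W \<subset> carrier_vec n"
  shows "flow_preimage \<sigma> W \<noteq> carrier_vec n"
proof
  assume *: "flow_preimage \<sigma> W = carrier_vec n"
  have "carrier_vec n = flow \<sigma> ` flow_preimage \<sigma> W"
    using flow_surj[OF assms(1)] * by simp
  also have "\<dots> \<subseteq> W" by (auto simp: flow_preimage_def)
  finally show False using assms by auto
qed

lemma sdim_flow_preimage: "word \<sigma> \<Longrightarrow> sdim (flow_preimage \<sigma> W) \<le> sdim W"
proof (induction \<sigma>)
  case Nil
  show ?case by (intro sdim_mono) (auto simp: flow_preimage_def)
next
  case (Cons i \<sigma>)
  have "flow_preimage (i # \<sigma>) W = {x \<in> carrier_vec n. A i *\<^sub>v x \<in> flow_preimage \<sigma> W}"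
    using Cons.prems by (auto simp: flow_preimage_def A_mult_carrier)
  then have "sdim (flow_preimage (i # \<sigma>) W) \<le> sdim (flow_preimage \<sigma> W)"
    using sdim_preimage_le[OF A_carrier A_invertible, of i] Cons.prems by simp
  then show ?case using Cons by simp
qed

section \<open>Input ranges and reachable subspaces\<close>

lemma input_range_carrier: "i < m \<Longrightarrow> input_range i \<subseteq> carrier_vec n"
  by (auto simp: input_range_def intro!: mult_mat_vec_carrier[OF B_carrier])

lemma zero_input_range: "i < m \<Longrightarrow> 0\<^sub>v n \<in> input_range i"
  unfolding input_range_def using dim_row_B[of i]
  by (intro CollectI exI[of _ "0\<^sub>v (dim_col (B i))"]) auto

lemma input_range_submodule:
  assumes "i < m"
  shows "submodule class_ring (input_range i) V"
proof (rule submodule_vecI)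
  show "x + y \<in> input_range i" if "x \<in> input_range i" "y \<in> input_range i" for x y
  proof -
    obtain u v where "x = B i *\<^sub>v u" "u \<in> carrier_vec (dim_col (B i))"
      "y = B i *\<^sub>v v" "v \<in> carrier_vec (dim_col (B i))"
      using \<open>x \<in> input_range i\<close> \<open>y \<in> input_range i\<close> by (auto simp: input_range_def)
    then show ?thesis unfolding input_range_def
      by (intro CollectI exI[of _ "u + v"]) (auto simp: mult_add_distrib_mat_vec[OF B_carrier[OF assms]])
  qed
  show "c \<cdot>\<^sub>v x \<in> input_range i" if "x \<in> input_range i" for c x
  proof -
    obtain u where "x = B i *\<^sub>v u" "u \<in> carrier_vec (dim_col (B i))"
      using \<open>x \<in> input_range i\<close> by (auto simp: input_range_def)
    then show ?thesis unfolding input_range_def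
      by (intro CollectI exI[of _ "c \<cdot>\<^sub>v u"]) (auto simp: mult_mat_vec[OF B_carrier[OF assms]])
  qed
qed (use assms in \<open>simp_all add: input_range_carrier zero_input_range\<close>)

lemma reach_Nil: "R [] = {0\<^sub>v n}"
  by (simp add: reach_def)

lemma reach_snoc: "R (\<pi> @ [i]) = {A i *\<^sub>v x + y | x y. x \<in> R \<pi> \<and> y \<in> input_range i}"
  unfolding reach_def input_range_def by auto

lemma reach_submodule: "word \<pi> \<Longrightarrow> submodule class_ring (R \<pi>) V"
proof (induction \<pi> rule: rev_induct)
  case Nil
  show ?case by (rule submodule_vecI) (auto simp: reach_Nil)
next
  case (snoc i \<pi>)
  then have i: "i < m" and IH: "submodule class_ring (R \<pi>) V" by auto
  note S = submodule_vecD[OF IH] and T = submodule_vecD[OF input_range_submodule[OF i]]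
  show ?case
  proof (rule submodule_vecI)
    show "R (\<pi> @ [i]) \<subseteq> carrier_vec n"
      using S(1) T(1) A_mult_carrier[OF i] by (auto simp: reach_snoc)
    show "0\<^sub>v n \<in> R (\<pi> @ [i])"
      using S(2) T(2) flow_zero[of "[i]"] i unfolding reach_snoc
      by (intro CollectI exI[of _ "0\<^sub>v n"]) auto
    show "x + y \<in> R (\<pi> @ [i])" if "x \<in> R (\<pi> @ [i])" "y \<in> R (\<pi> @ [i])" for x y
    proof -
      obtain a b where x: "x = A i *\<^sub>v a + b" "a \<in> R \<pi>" "b \<in> input_range i"
        using \<open>x \<in> R (\<pi> @ [i])\<close> by (auto simp: reach_snoc)
      obtain c d where y: "y = A i *\<^sub>v c + d" "c \<in> R \<pi>" "d \<in> input_range i"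
        using \<open>y \<in> R (\<pi> @ [i])\<close> by (auto simp: reach_snoc)
      have carr: "a \<in> carrier_vec n" "b \<in> carrier_vec n" "c \<in> carrier_vec n" "d \<in> carrier_vec n"
        using x y S(1) T(1) by auto
      have "x + y = A i *\<^sub>v (a + c) + (b + d)"
        using carr A_carrier[OF i] A_mult_carrier[OF i] unfolding x y
        by (subst mult_add_distrib_mat_vec) (auto intro!: eq_vecI)
      then show ?thesis unfolding reach_snoc using x y S(3) T(3) by blast
    qed
    show "c \<cdot>\<^sub>v x \<in> R (\<pi> @ [i])" if "x \<in> R (\<pi> @ [i])" for c x
    proof -
      obtain a b where x: "x = A i *\<^sub>v a + b" "a \<in> R \<pi>" "b \<in> input_range i"
        using \<open>x \<in> R (\<pi> @ [i])\<close> by (auto simp: reach_snoc)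
      have carr: "a \<in> carrier_vec n" "b \<in> carrier_vec n"
        using x S(1) T(1) by auto
      have "c \<cdot>\<^sub>v x = A i *\<^sub>v (c \<cdot>\<^sub>v a) + c \<cdot>\<^sub>v b"
        using carr A_mult_carrier[OF i] unfolding x
        by (simp add: smult_add_distrib_vec[of _ n] mult_mat_vec[OF A_carrier[OF i]])
      then show ?thesis unfolding reach_snoc using x S(4) T(4) by blast
    qed
  qed
qed

lemma reach_carrier: "word \<pi> \<Longrightarrow> R \<pi> \<subseteq> carrier_vec n"
  using submodule_vecD(1)[OF reach_submodule] .

lemma reach_singleton:
  assumes "i < m"
  shows "R [i] = input_range i"
proof -
  have "0\<^sub>v n + y = y" if "y \<in> input_range i" for y
    using that input_range_carrier[OF assms] by auto
  then show ?thesis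
    using reach_snoc[of "[]" i] flow_zero[of "[i]"] assms by (force simp: reach_Nil)
qed

text \<open>A trajectory that has reached \<open>x\<close> is continued along \<open>\<pi>\<close>
  with zero input.\<close>

lemma flow_reach: "word \<sigma> \<Longrightarrow> word \<pi> \<Longrightarrow> x \<in> R \<sigma> \<Longrightarrow> flow \<pi> x \<in> R (\<sigma> @ \<pi>)"
proof (induction \<pi> rule: rev_induct)
  case (snoc i \<pi>)
  then have i: "i < m" by simp
  have y: "flow \<pi> x \<in> R (\<sigma> @ \<pi>)" using snoc by simp
  moreover have "R (\<sigma> @ \<pi>) \<subseteq> carrier_vec n" using snoc.prems by (intro reach_carrier) auto
  ultimately have "A i *\<^sub>v flow \<pi> x = A i *\<^sub>v flow \<pi> x + 0\<^sub>v n"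
    using A_mult_carrier[OF i] by auto
  then have "A i *\<^sub>v flow \<pi> x \<in> R ((\<sigma> @ \<pi>) @ [i])"
    unfolding reach_snoc using y zero_input_range[OF i] by blast
  then show ?case by (simp add: flow_append)
qed simp

text \<open>With zero inputs along \<open>\<sigma>\<close> the state is still 0 when
  \<open>\<pi>\<close> starts. Formally, 0 lies in \<open>R \<sigma>\<close>, and each further
  letter acts monotonically on sets of states.\<close>

lemma reach_suffix: "word \<sigma> \<Longrightarrow> R \<pi> \<subseteq> R (\<sigma> @ \<pi>)"
proof (induction \<pi> rule: rev_induct)
  case Nil
  then show ?case using submodule_vecD(2)[OF reach_submodule[of \<sigma>]] by (simp add: reach_Nil)
next
  case (snoc i \<pi>)
  then show ?case unfolding append_assoc[symmetric] reach_snoc by blast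
qed

text \<open>The sets of states that stay in \<open>U\<close> under all words of length at most \<open>j\<close> decrease
  with \<open>j\<close>, and strictly so until they become invariant.\<close>

lemma escape_word:
  assumes U: "submodule class_ring U V" "U \<noteq> carrier_vec n"
    and G: "G \<subseteq> carrier_vec n" "\<And>X. invariant X \<Longrightarrow> G \<subseteq> X \<Longrightarrow> X = carrier_vec n"
    and k: "sdim U < k + sdim G"
  obtains x \<sigma> where "x \<in> G" "word \<sigma>" "length \<sigma> \<le> k" "flow \<sigma> x \<notin> U"
proof (rule ccontr)
  assume neg: "\<not> thesis"
  define T where "T j = (\<Inter>\<sigma>\<in>{\<sigma>. word \<sigma> \<and> length \<sigma> \<le> j}. flow_preimage \<sigma> U)" for j
  have memT: "x \<in> T j \<longleftrightarrow> x \<in> carrier_vec n \<and> (\<forall>\<sigma>. word \<sigma> \<longrightarrow> length \<sigma> \<le> j \<longrightarrow> flow \<sigma> x \<in> U)" for x j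
    by (auto simp: T_def flow_preimage_def dest: spec[of _ "[]"])
  have GT: "G \<subseteq> T k" using neg that G(1) unfolding memT subset_iff by blast
  have anti: "T j \<subseteq> T i" if "i \<le> j" for i j using that by (auto simp: memT)
  have TU: "T 0 \<subseteq> U" by (auto simp: memT dest: spec[of _ "[]"])
  have subT: "submodule class_ring (T j) V" for j
    using submodule_vecD[OF U(1)]
    by (intro submodule_vecI) (auto simp: memT flow_add flow_smult flow_zero)
  have strict: "T (Suc j) \<subset> T j" if "j < k" for j
  proof (rule ccontr)
    assume "\<not> T (Suc j) \<subset> T j"
    then have eq: "T (Suc j) = T j" using anti[of j "Suc j"] by auto
    have "invariant (T j)" unfolding invariant_def
    proof (intro conjI allI impI ballI subT)
      fix i x assume i: "i < m" and "x \<in> T j"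
      then have x: "x \<in> T (Suc j)" using eq by simp
      \<comment> \<open>The word \<open>i # \<sigma>\<close> has length at most
        \<open>Suc j\<close>, so membership of \<open>x\<close> in \<open>T (Suc j)\<close> applies
        to it.\<close>
      have "flow \<sigma> (A i *\<^sub>v x) \<in> U" if "word \<sigma>" "length \<sigma> \<le> j" for \<sigma>
        using x[unfolded memT, THEN conjunct2, rule_format, of "i # \<sigma>"] that i by simp
      then show "A i *\<^sub>v x \<in> T j" using x A_mult_carrier[OF i] by (auto simp: memT)
    qed
    \<comment> \<open>\<open>T j\<close> contains \<open>T k\<close> and hence \<open>G\<close>, so
      the invariant \<open>T j\<close> is the whole space, although it lies in \<open>T 0\<close>
      and so in the proper subspace \<open>U\<close>.\<close>
    then have "T j = carrier_vec n" using G(2) GT anti[of j k] that by auto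
    then show False
      using TU anti[of 0 j] U submodule_vecD(1)[OF U(1)] by auto
  qed
  have "j \<le> k \<Longrightarrow> sdim (T j) + j \<le> sdim U" for j
  proof (induction j)
    case 0
    then show ?case using sdim_mono[OF TU] by simp
  next
    case (Suc j)
    then have "sdim (T (Suc j)) < sdim (T j)"
      using strict[of j] by (intro sdim_strict_mono subT) (auto simp: memT)
    then show ?case using Suc by simp
  qed
  \<comment> \<open>After \<open>k\<close> strict drops the dimension of \<open>T k\<close> is at
    most \<open>sdim U - k\<close>, which is too small for \<open>T k\<close> to contain
    \<open>G\<close>.\<close>
  from this[of k] show False using sdim_mono[OF GT] k by simp
qed

end

section \<open>The upper bound\<close>

text \<open>Controllability enters only through \<open>invariant_full\<close>. It is derived from
  \<open>controllable_sys\<close> for the upper bound, and verified directly for the example, whose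
  controllability is then a consequence.\<close>

locale ranked_switched_system = switched_system +
  fixes r :: nat
  assumes r_le: "r \<le> n"
    and m_pos: "0 < m"
    and rank_B: "\<And>i. i < m \<Longrightarrow> r \<le> rank (B i)"
    and invariant_full:
      "\<And>X. invariant X \<Longrightarrow> (\<And>i. i < m \<Longrightarrow> input_range i \<subseteq> X) \<Longrightarrow> X = carrier_vec n"
begin

lemma r_le_sdim_input_range: "i < m \<Longrightarrow> r \<le> sdim (input_range i)"
  using rank_B[of i] rank_le_sdim_range[OF B_carrier, of i] by (auto simp: input_range_def)

text \<open>The inputs together span at least \<open>r + 1\<close> dimensions, so
  \<open>sdim (R \<pi>) - r\<close> steps suffice for some input to leave the preimage of
  \<open>R \<pi>\<close>. One more letter in front supplies that input.\<close>

lemma reach_increase_distinct: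
  assumes \<pi>: "word \<pi>" "R \<pi> \<noteq> carrier_vec n" "r \<le> sdim (R \<pi>)"
    and big: "r < sdim (\<Union>i<m. input_range i)"
  obtains \<pi>' where "word \<pi>'" "\<pi>' \<noteq> []" "R \<pi> \<subset> R \<pi>'"
    "length \<pi>' \<le> length \<pi> + (sdim (R \<pi>) - r + 1)"
proof -
  let ?U = "flow_preimage \<pi> (R \<pi>)" and ?G = "\<Union>i<m. input_range i"
  have sub: "R \<pi> \<subset> carrier_vec n" using reach_carrier \<pi> by auto
  have "sdim ?U < (sdim (R \<pi>) - r) + sdim ?G"
    using sdim_flow_preimage[OF \<pi>(1), of "R \<pi>"] big \<pi>(3) by simp
  then obtain x \<sigma> where x: "x \<in> ?G" "word \<sigma>" "length \<sigma> \<le> sdim (R \<pi>) - r" "flow \<sigma> x \<notin> ?U"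
  proof (rule escape_word[rotated 4])
    show "submodule class_ring ?U V" by (intro flow_preimage_submodule reach_submodule \<pi>)
    show "?U \<noteq> carrier_vec n" by (intro flow_preimage_proper \<pi> sub)
    show "?G \<subseteq> carrier_vec n" using input_range_carrier by auto
    show "X = carrier_vec n" if "invariant X" "?G \<subseteq> X" for X
      using that by (intro invariant_full) auto
  qed
  then obtain i where i: "i < m" "x \<in> R [i]" using reach_singleton by auto
  let ?w = "(i # \<sigma>) @ \<pi>"
  have "flow \<sigma> x \<in> carrier_vec n"
    using x i input_range_carrier reach_singleton by (intro flow_carrier) auto
  then have "flow \<pi> (flow \<sigma> x) \<notin> R \<pi>" using x by (simp add: flow_preimage_def)
  moreover have "flow \<pi> (flow \<sigma> x) \<in> R ?w"
    using flow_reach[of "i # \<sigma>" \<pi> "flow \<sigma> x"] flow_reach[of "[i]" \<sigma> x] i x \<pi> by simp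
  moreover have "R \<pi> \<subseteq> R ?w" using i x by (intro reach_suffix) auto
  ultimately show thesis using i x \<pi> by (intro that[of ?w]) auto
qed

text \<open>With equal input ranges, changing the first letter of a word does not change the reachable
  set. So the escaping word is inserted after the first letter \<open>j\<close> of \<open>\<pi> = j # \<rho>\<close>, and only has to
  leave the preimage under the flow of \<open>\<rho>\<close>, which contains the common range.\<close>

lemma reach_increase_equal:
  assumes \<pi>: "word \<pi>" "\<pi> \<noteq> []" "R \<pi> \<noteq> carrier_vec n" "r \<le> sdim (R \<pi>)"
    and small: "sdim (\<Union>i<m. input_range i) \<le> r"
  obtains \<pi>' where "word \<pi>'" "\<pi>' \<noteq> []" "R \<pi> \<subset> R \<pi>'"
    "length \<pi>' \<le> length \<pi> + (sdim (R \<pi>) - r + 1)"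
proof -
  obtain j \<rho> where \<pi>_eq: "\<pi> = [j] @ \<rho>" and j: "j < m" and \<rho>: "word \<rho>"
    using \<pi> by (cases \<pi>) auto
  \<comment> \<open>A subspace of dimension at least \<open>r\<close> inside a set of
    \<open>sdim\<close> at most \<open>r\<close> exhausts it.\<close>
  have same: "input_range i = (\<Union>i<m. input_range i)" if "i < m" for i
  proof (rule ccontr)
    assume "input_range i \<noteq> (\<Union>i<m. input_range i)"
    then have "sdim (input_range i) < sdim (\<Union>i<m. input_range i)"
      using that input_range_carrier by (intro sdim_strict_mono input_range_submodule) auto
    then show False using small r_le_sdim_input_range[OF that] by simp
  qed
  have eq: "input_range i = input_range j" if "i < m" for i
    using same[OF that] same[OF j] by (rule trans[OF _ sym])
  have prefix: "R ([i] @ \<tau>) = R ([j] @ \<tau>)" if "i < m" for i \<tau>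
  proof (induction \<tau> rule: rev_induct)
    case Nil
    then show ?case using eq[OF that] reach_singleton that j by simp
  next
    case (snoc a \<tau>)
    then show ?case unfolding append_assoc[symmetric] reach_snoc by simp
  qed
  let ?U = "flow_preimage \<rho> (R \<pi>)" and ?G = "input_range j"
  have sub: "R \<pi> \<subset> carrier_vec n" using reach_carrier \<pi> by auto
  have GU: "?G \<subseteq> ?U"
    using flow_reach[of "[j]" \<rho>] reach_singleton[OF j] input_range_carrier[OF j] j \<rho>
    by (auto simp: flow_preimage_def \<pi>_eq)
  \<comment> \<open>Here \<open>?G\<close> is only known to have dimension at least
    \<open>r\<close>, so one more step is allowed than for distinct ranges.\<close>
  have "sdim ?U < (sdim (R \<pi>) - r + 1) + sdim ?G"
    using sdim_flow_preimage[OF \<rho>, of "R \<pi>"] r_le_sdim_input_range[OF j] \<pi>(4) by simp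
  then obtain x \<sigma> where x: "x \<in> ?G" "word \<sigma>" "length \<sigma> \<le> sdim (R \<pi>) - r + 1" "flow \<sigma> x \<notin> ?U"
  proof (rule escape_word[rotated 4])
    show "submodule class_ring ?U V" by (intro flow_preimage_submodule reach_submodule \<pi> \<rho>)
    show "?U \<noteq> carrier_vec n" by (intro flow_preimage_proper \<rho> sub)
    show "?G \<subseteq> carrier_vec n" using input_range_carrier[OF j] .
    show "X = carrier_vec n" if "invariant X" "?G \<subseteq> X" for X
      using that eq by (intro invariant_full) blast+
  qed
  \<comment> \<open>The last letter \<open>i\<close> of \<open>\<sigma>\<close> takes over the role
    of \<open>j\<close> in front of \<open>\<rho>\<close>: both first letters give
    \<open>R \<pi>\<close>, which makes it a subset of \<open>R ?w\<close>. Since \<open>j\<close>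
    itself moves to the front of \<open>\<sigma>\<close>, the word grows only by the length of
    \<open>\<sigma>\<close>.\<close>
  have "\<sigma> \<noteq> []" using x GU by auto
  then obtain \<sigma>' i where \<sigma>: "\<sigma> = \<sigma>' @ [i]" by (metis rev_exhaust)
  let ?w = "([j] @ \<sigma>) @ \<rho>"
  have "flow \<sigma> x \<in> carrier_vec n"
    using x input_range_carrier[OF j] by (intro flow_carrier) auto
  then have "flow \<rho> (flow \<sigma> x) \<notin> R \<pi>" using x by (simp add: flow_preimage_def)
  moreover have "flow \<rho> (flow \<sigma> x) \<in> R ?w"
    using j x \<rho> reach_singleton[OF j] by (intro flow_reach) auto
  moreover have "R \<pi> \<subseteq> R ?w"
  proof -
    have "R \<pi> = R ([i] @ \<rho>)" using prefix[of i \<rho>] x \<sigma> by (simp add: \<pi>_eq)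
    also have "\<dots> \<subseteq> R (([j] @ \<sigma>') @ ([i] @ \<rho>))" using j x \<sigma> by (intro reach_suffix) auto
    finally show ?thesis by (simp add: \<sigma>)
  qed
  ultimately show thesis using j x \<pi> \<rho> by (intro that[of ?w]) (auto simp: \<pi>_eq)
qed

text \<open>The first letter gives dimension at least \<open>r\<close>, and going beyond dimension
  \<open>r + k\<close> costs at most \<open>k + 1\<close> further letters. If the dimension is
  already larger, the word is kept.\<close>

lemma reach_sdim_growth:
  "k \<le> n - r \<Longrightarrow>
    \<exists>\<pi>. word \<pi> \<and> \<pi> \<noteq> [] \<and> r + k \<le> sdim (R \<pi>) \<and> length \<pi> \<le> k * (k + 1) div 2 + 1"
proof (induction k)
  case 0
  then show ?case
    using m_pos r_le_sdim_input_range[of 0] reach_singleton[of 0] by (intro exI[of _ "[0]"]) auto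
next
  case (Suc k)
  then obtain \<pi> where \<pi>: "word \<pi>" "\<pi> \<noteq> []" "r + k \<le> sdim (R \<pi>)" "length \<pi> \<le> k * (k + 1) div 2 + 1"
    by auto
  have sum: "Suc k * (Suc k + 1) div 2 = k * (k + 1) div 2 + (k + 1)" by simp
  show ?case
  proof (cases "sdim (R \<pi>) = r + k")
    case True
    then have "R \<pi> \<noteq> carrier_vec n" using Suc.prems sdim_carrier by auto
    then obtain \<pi>' where \<pi>': "word \<pi>'" "\<pi>' \<noteq> []" "R \<pi> \<subset> R \<pi>'"
      "length \<pi>' \<le> length \<pi> + (sdim (R \<pi>) - r + 1)"
      using reach_increase_distinct[of \<pi>] reach_increase_equal[of \<pi>] \<pi> True
      by (metis le_add1 not_le)
    moreover have "sdim (R \<pi>) < sdim (R \<pi>')"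
      using \<pi> \<pi>' by (intro sdim_strict_mono reach_submodule reach_carrier)
    ultimately show ?thesis using True \<pi> sum by (intro exI[of _ \<pi>']) simp
  next
    case False
    then show ?thesis using \<pi> sum by (intro exI[of _ \<pi>]) simp
  qed
qed

lemma short_controllable_seq:
  "\<exists>\<pi>. word \<pi> \<and> controllable_seq n A B \<pi> \<and> length \<pi> \<le> (n - r + 1) * (n - r) div 2 + 1"
proof -
  obtain \<pi> where \<pi>: "word \<pi>" "n \<le> sdim (R \<pi>)" "length \<pi> \<le> (n - r) * (n - r + 1) div 2 + 1"
    using reach_sdim_growth[of "n - r"] r_le by auto
  have "R \<pi> = carrier_vec n"
    using sdim_strict_mono[OF reach_submodule, of \<pi> "carrier_vec n"] reach_carrier[of \<pi>]
      sdim_carrier \<pi> by auto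
  then show ?thesis
    using \<pi> by (intro exI[of _ \<pi>]) (simp add: controllable_seq_def mult.commute)
qed

end

text \<open>Starting from 0, no word leads out of an invariant subspace that contains all inputs, so
  the union of the reachable sets lies in \<open>X\<close>.\<close>

lemma (in switched_system) invariant_full_of_controllable_sys:
  assumes ctrl: "controllable_sys n m A B"
    and X: "invariant X" "\<And>i. i < m \<Longrightarrow> input_range i \<subseteq> X"
  shows "X = carrier_vec n"
proof
  have sub: "submodule class_ring X V" using X by (simp add: invariant_def)
  show "X \<subseteq> carrier_vec n" using submodule_vecD(1)[OF sub] .
  have "word \<pi> \<Longrightarrow> R \<pi> \<subseteq> X" for \<pi>
  proof (induction \<pi> rule: rev_induct)
    case Nil
    then show ?case using submodule_vecD(2)[OF sub] by (simp add: reach_Nil)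
  next
    case (snoc i \<pi>)
    then have i: "i < m" and IH: "R \<pi> \<subseteq> X" by auto
    show ?case
    proof
      fix z assume "z \<in> R (\<pi> @ [i])"
      then obtain x y where z: "z = A i *\<^sub>v x + y" and x: "x \<in> X" and y: "y \<in> X"
        using IH X(2)[OF i] by (auto simp: reach_snoc)
      have "A i *\<^sub>v x \<in> X" using X(1) x i by (simp add: invariant_def)
      then show "z \<in> X" unfolding z by (rule submodule_vecD(3)[OF sub _ y])
    qed
  qed
  then have "(\<Union>\<pi>\<in>{\<pi>. word \<pi>}. R \<pi>) \<subseteq> X" by blast
  then show "carrier_vec n \<subseteq> X" using ctrl by (simp add: controllable_sys_def)
qed

section \<open>Slowly controllable systems\<close>

definition perm_mat :: "nat \<Rightarrow> (nat \<Rightarrow> nat) \<Rightarrow> real mat" where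
  "perm_mat n f = mat n n (\<lambda>(a, b). if a = f b then 1 else 0)"

lemma perm_mat_carrier [simp]: "perm_mat n f \<in> carrier_mat n n"
  and dim_perm_mat [simp]: "dim_row (perm_mat n f) = n" "dim_col (perm_mat n f) = n"
  by (simp_all add: perm_mat_def)

lemma perm_mat_mult:
  assumes "\<And>b. b < n \<Longrightarrow> g b < n"
  shows "perm_mat n f * perm_mat n g = perm_mat n (f \<circ> g)"
proof (rule eq_matI)
  fix a b assume "a < dim_row (perm_mat n (f \<circ> g))" "b < dim_col (perm_mat n (f \<circ> g))"
  then have ab: "a < n" "b < n" by simp_all
  have "(perm_mat n f * perm_mat n g) $$ (a, b)
      = (\<Sum>c = 0..<n. (if a = f c then 1 else 0) * (if c = g b then 1 else 0))"
    using ab by (simp add: perm_mat_def scalar_prod_def)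
  also have "\<dots> = (\<Sum>c = 0..<n. if c = g b then (if a = f c then 1 else 0) else 0)"
    by (intro sum.cong) auto
  also have "\<dots> = perm_mat n (f \<circ> g) $$ (a, b)"
    using ab assms by (simp add: perm_mat_def)
  finally show "(perm_mat n f * perm_mat n g) $$ (a, b) = perm_mat n (f \<circ> g) $$ (a, b)" .
qed simp_all

lemma perm_mat_invertible:
  assumes "f permutes {..<n}"
  shows "invertible_mat (perm_mat n f)"
proof -
  have id: "perm_mat n id = 1\<^sub>m n" by (auto simp: perm_mat_def)
  let ?g = "inv_into UNIV f"
  have "perm_mat n f * perm_mat n ?g = perm_mat n (f \<circ> ?g)"
    "perm_mat n ?g * perm_mat n f = perm_mat n (?g \<circ> f)"
    using permutes_in_image[OF assms] permutes_in_image[OF permutes_inv[OF assms]]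
    by (auto intro!: perm_mat_mult)
  then have "inverts_mat (perm_mat n f) (perm_mat n ?g)" "inverts_mat (perm_mat n ?g) (perm_mat n f)"
    using id permutes_inv_o[OF assms] by (simp_all add: inverts_mat_def)
  then show ?thesis unfolding invertible_mat_def by auto
qed

text \<open>By injectivity of \<open>f\<close>, row \<open>f b\<close> has its only 1 in column
  \<open>b\<close>.\<close>

lemma perm_mat_mult_vec_index:
  assumes f: "f permutes {..<n}" and x: "x \<in> carrier_vec n" and b: "b < n"
  shows "(perm_mat n f *\<^sub>v x) $ f b = x $ b"
proof -
  have "f b < n" using permutes_in_image[OF f] b by simp
  then have "(perm_mat n f *\<^sub>v x) $ f b = (\<Sum>c = 0..<n. (if f b = f c then 1 else 0) * x $ c)"
    using x by (simp add: perm_mat_def scalar_prod_def)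
  also have "\<dots> = (\<Sum>c = 0..<n. if c = b then x $ c else 0)"
    using permutes_inj[OF f] by (intro sum.cong) (auto dest: injD)
  finally show ?thesis using b by simp
qed

lemma perm_mat_unit_vec:
  assumes "b < n"
  shows "perm_mat n f *\<^sub>v unit_vec n b = unit_vec n (f b)"
  using assms by (intro eq_vecI) (auto simp: perm_mat_def, simp add: unit_vec_def)

section \<open>The example system and its weights\<close>

definition cycle_from :: "nat \<Rightarrow> nat \<Rightarrow> nat \<Rightarrow> nat" where
  "cycle_from c n x = (if x < c \<or> n \<le> x then x else if Suc x < n then Suc x else c)"

lemma cycle_from_permutes:
  assumes "c < n"
  shows "cycle_from c n permutes {..<n}"
proof (rule bij_imp_permutes)
  show "bij_betw (cycle_from c n) {..<n} {..<n}"
    \<comment> \<open>The witness runs the cycle \<open>c\<close>, ..., \<open>n - 1\<close>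
      backwards.\<close>
    by (rule bij_betw_byWitness[of _ "\<lambda>x. if x < c then x else if x = c then n - 1 else x - 1"])
      (use assms in \<open>auto simp: cycle_from_def\<close>)
qed (simp add: cycle_from_def)

text \<open>Here \<open>r = Suc q\<close>, coordinates count from 0, and \<open>Suc l\<close> is the number of genuinely different
  modes: every mode from \<open>l\<close> on is the same cycle.\<close>

definition example_perm :: "nat \<Rightarrow> nat \<Rightarrow> nat \<Rightarrow> nat \<Rightarrow> nat \<Rightarrow> nat" where
  "example_perm n q l i =
     (if i < l then transpose (q + i) (Suc (q + i)) else cycle_from (q + l) n)"

definition example_A :: "nat \<Rightarrow> nat \<Rightarrow> nat \<Rightarrow> nat \<Rightarrow> real mat" where
  "example_A n q l i = perm_mat n (example_perm n q l i)"

definition example_B :: "nat \<Rightarrow> nat \<Rightarrow> nat \<Rightarrow> real mat" where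
  "example_B n q i = mat n (Suc q) (\<lambda>(a, b). if a = b then 1 else 0)"

lemma example_carrier [simp]:
  "example_A n q l i \<in> carrier_mat n n" "example_B n q i \<in> carrier_mat n (Suc q)"
  and example_dim [simp]:
  "dim_row (example_A n q l i) = n" "dim_col (example_A n q l i) = n"
  "dim_row (example_B n q i) = n" "dim_col (example_B n q i) = Suc q"
  by (simp_all add: example_A_def example_B_def)

lemma example_perm_permutes: "Suc (q + l) < n \<Longrightarrow> example_perm n q l i permutes {..<n}"
  using cycle_from_permutes[of "q + l" n] permutes_swap_id[of "q + i" "{..<n}" "Suc (q + i)"]
  by (auto simp: example_perm_def)

text \<open>The weight \<open>min (x - q) (Suc l)\<close> is 0 up to \<open>q\<close>, rises by one
  per coordinate and is constant from \<open>q + l + 1\<close> on. A transposition raises only the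
  weight of \<open>q + i\<close>. The cycle raises only that of \<open>q + l\<close>: later
  coordinates keep the top weight, and the step back to \<open>q + l\<close> does not raise
  it.\<close>

lemma example_perm_weight_le:
  assumes "x < n"
  shows "min (example_perm n q l i x - q) (Suc l)
    \<le> min (x - q) (Suc l) + (if x = q + min i l then 1 else 0)"
proof (cases "i < l")
  case True
  then show ?thesis by (auto simp: example_perm_def transpose_def)
next
  case False
  then show ?thesis using assms by (auto simp: example_perm_def cycle_from_def)
qed

text \<open>The set on the left is the index set after one more step. The inputs add coordinates of
  weight 0, and at most one element of \<open>S\<close> gains weight.\<close>

lemma sum_example_weight_image:
  assumes "Suc (q + l) < n" "S \<subseteq> {..<n}"
  shows "(\<Sum>x \<in> {..<Suc q} \<union> example_perm n q l i ` S. min (x - q) (Suc l))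
    \<le> Suc (\<Sum>x\<in>S. min (x - q) (Suc l))"
proof -
  let ?w = "\<lambda>x. min (x - q) (Suc l)" and ?f = "example_perm n q l i"
  have fin: "finite S" using assms(2) finite_subset by blast
  have inj: "inj_on ?f S"
    using permutes_inj[OF example_perm_permutes[OF assms(1)]] by (rule inj_on_subset) simp
  have "(\<Sum>x \<in> {..<Suc q} \<union> ?f ` S. ?w x) \<le> sum ?w {..<Suc q} + sum ?w (?f ` S)"
    using sum.union_inter[of "{..<Suc q}" "?f ` S" ?w] fin by simp
  also have "sum ?w {..<Suc q} = 0" by simp
  also have "sum ?w (?f ` S) = (\<Sum>x\<in>S. ?w (?f x))"
    using inj by (simp add: sum.reindex)
  also have "0 + \<dots> \<le> (\<Sum>x\<in>S. ?w x + (if x = q + min i l then 1 else 0))"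
    unfolding add_0 using assms(2) by (intro sum_mono example_perm_weight_le) auto
  also have "\<dots> \<le> Suc (sum ?w S)" using fin by (simp add: sum.distrib)
  finally show ?thesis .
qed

lemma row_example_B_scalar_prod:
  assumes "u \<in> carrier_vec (Suc q)" "Suc q \<le> a" "a < n"
  shows "row (example_B n q i) a \<bullet> u = 0"
  using assms by (auto simp: example_B_def scalar_prod_def intro!: sum.neutral)

text \<open>Every set reachable in \<open>k\<close> steps lies in a coordinate subspace whose index set has
  weight below \<open>k\<close>: a step increases the weight of just one index, by one.\<close>

lemma example_reach_support:
  assumes ql: "Suc (q + l) < n" and "\<rho> \<noteq> []"
  shows "\<exists>S \<subseteq> {..<n}. (\<Sum>x\<in>S. min (x - q) (Suc l)) < length \<rho> \<and>
    (\<forall>x \<in> reach_rev n (example_A n q l) (example_B n q) \<rho>.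
      x \<in> carrier_vec n \<and> (\<forall>a<n. a \<notin> S \<longrightarrow> x $ a = 0))"
  using \<open>\<rho> \<noteq> []\<close>
proof (induction \<rho> rule: list_nonempty_induct)
  \<comment> \<open>One letter reaches only the first \<open>Suc q\<close> coordinates, of total
    weight \<open>0 < 1\<close>.\<close>
  case (single i)
  have "example_A n q l i *\<^sub>v 0\<^sub>v n = 0\<^sub>v n"
    by (intro eq_vecI) (auto simp: example_A_def)
  then show ?case using ql
    by (intro exI[of _ "{..<Suc q}"])
      (auto simp: row_example_B_scalar_prod intro!: add_carrier_vec mult_mat_vec_carrier[of _ n "Suc q"])
next
  case (cons i \<rho>)
  let ?f = "example_perm n q l i"
  obtain S where S: "S \<subseteq> {..<n}" "(\<Sum>x\<in>S. min (x - q) (Suc l)) < length \<rho>"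
    and supp: "\<And>x. x \<in> reach_rev n (example_A n q l) (example_B n q) \<rho> \<Longrightarrow> x \<in> carrier_vec n"
      "\<And>x a. x \<in> reach_rev n (example_A n q l) (example_B n q) \<rho> \<Longrightarrow> a < n \<Longrightarrow> a \<notin> S \<Longrightarrow> x $ a = 0"
    using cons.IH by blast
  have perm: "?f permutes {..<n}" by (rule example_perm_permutes[OF ql])
  let ?S = "{..<Suc q} \<union> ?f ` S"
  have "?S \<subseteq> {..<n}" using permutes_in_image[OF perm] S(1) ql by auto
  moreover have "(\<Sum>x\<in>?S. min (x - q) (Suc l)) < length (i # \<rho>)"
    using sum_example_weight_image[OF ql S(1), of i] S(2) by simp
  moreover have "z \<in> carrier_vec n \<and> (\<forall>a<n. a \<notin> ?S \<longrightarrow> z $ a = 0)"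
    if z_in: "z \<in> reach_rev n (example_A n q l) (example_B n q) (i # \<rho>)" for z
  proof -
    obtain x u where z: "z = example_A n q l i *\<^sub>v x + example_B n q i *\<^sub>v u"
      and x: "x \<in> reach_rev n (example_A n q l) (example_B n q) \<rho>" and u: "u \<in> carrier_vec (Suc q)"
      using z_in unfolding reach_rev.simps example_dim by blast
    have carr: "example_A n q l i *\<^sub>v x \<in> carrier_vec n" "example_B n q i *\<^sub>v u \<in> carrier_vec n"
      by (rule mult_mat_vec_carrier[OF example_carrier(1) supp(1)[OF x]],
          rule mult_mat_vec_carrier[OF example_carrier(2) u])
    have "z $ a = 0" if a: "a < n" "a \<notin> ?S" for a
    proof -
      \<comment> \<open>As \<open>a\<close> is not in the image of \<open>S\<close>, its preimage
        \<open>b\<close> is outside \<open>S\<close>, where \<open>x\<close> vanishes;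
        \<open>a\<close> is also beyond the coordinates that the input reaches.\<close>
      obtain b where b: "b < n" "a = ?f b"
        using permutes_image[OF perm] a(1) by (metis imageE lessThan_iff)
      have "(example_A n q l i *\<^sub>v x) $ a = x $ b"
        unfolding example_A_def b(2) by (rule perm_mat_mult_vec_index[OF perm supp(1)[OF x] b(1)])
      also have "\<dots> = 0" using supp(2)[OF x b(1)] a(2) b(2) by auto
      finally show ?thesis
        using row_example_B_scalar_prod[OF u, of a n i] a carr unfolding z by auto
    qed
    then show ?thesis using carr z by auto
  qed
  ultimately show ?case by blast
qed

section \<open>Total weight and the length of a controllable word\<close>

lemma sum_min_diff: "j \<le> Suc l \<Longrightarrow> (\<Sum>x<Suc (q + j). min (x - q) (Suc l)) = j * Suc j div 2"
  for q :: nat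
  by (induction j) auto

text \<open>For \<open>s = Suc l\<close> the weights 1, ..., \<open>Suc l\<close> sum to the bound
  exactly. Each further coordinate has weight \<open>Suc l\<close>, of which only 1 is
  counted.\<close>

lemma sum_min_diff_ge:
  fixes q s l :: nat
  assumes "Suc l \<le> s"
  shows "s + Suc l * l div 2 \<le> (\<Sum>x<Suc (q + s). min (x - q) (Suc l))"
  using assms
proof (induction s rule: dec_induct)
  case base
  have "Suc l * Suc (Suc l) = Suc l * l + Suc l * 2" by simp
  then have "Suc l * Suc (Suc l) div 2 = Suc l + Suc l * l div 2"
    by (simp only: div_mult_self1)
  then show ?case using sum_min_diff[of "Suc l" l q] by simp
next
  case (step s)
  have "(\<Sum>x<Suc (q + Suc s). min (x - q) (Suc l))
      = (\<Sum>x<Suc (q + s). min (x - q) (Suc l)) + Suc (min s l)" by simp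
  then show ?case using step.IH by linarith
qed

lemma example_controllable_length:
  assumes "Suc (q + l) < n" "controllable_seq n (example_A n q l) (example_B n q) \<pi>"
  shows "n - Suc q + 1 + Suc l * l div 2 \<le> length \<pi>"
proof -
  have full: "reach_rev n (example_A n q l) (example_B n q) (rev \<pi>) = carrier_vec n"
    using assms(2) unfolding controllable_seq_def reach_def .
  \<comment> \<open>The support bound speaks of nonempty words; the empty word reaches only 0, and
    \<open>n > 0\<close>.\<close>
  have "rev \<pi> \<noteq> []"
  proof
    assume "rev \<pi> = []"
    then have "carrier_vec n = {0\<^sub>v n :: real vec}" using full by simp
    then have "unit_vec n 0 = (0\<^sub>v n :: real vec)" using unit_vec_carrier[of n 0] by blast
    from arg_cong[OF this, of "\<lambda>v. v $ 0"] show False using assms(1) by simp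
  qed
  from example_reach_support[OF assms(1) this] obtain S where S: "S \<subseteq> {..<n}"
    "(\<Sum>x\<in>S. min (x - q) (Suc l)) < length \<pi>"
    "\<And>x a. x \<in> carrier_vec n \<Longrightarrow> a < n \<Longrightarrow> a \<notin> S \<Longrightarrow> x $ a = (0::real)"
    unfolding full by auto
  \<comment> \<open>Each unit vector is reachable, so \<open>S\<close> contains every coordinate,
    and the length exceeds the total weight of all of them.\<close>
  have "a \<in> S" if "a < n" for a
    using S(3)[of "unit_vec n a" a] that by auto
  then have "S = {..<n}" using S(1) by auto
  then have S_eq: "S = {..<Suc (q + (n - Suc q))}" using assms(1) by simp
  have "n - Suc q + Suc l * l div 2 \<le> (\<Sum>x\<in>S. min (x - q) (Suc l))"
    unfolding S_eq using assms(1) by (intro sum_min_diff_ge) simp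
  then show ?thesis using S(2) by linarith
qed

lemma rank_example_B:
  assumes "q < n"
  shows "vec_space.rank n (example_B n q i) = Suc q"
proof -
  interpret vec_space "TYPE(real)" n .
  have "col (example_B n q i) j = unit_vec n j" if "j < Suc q" for j
    using that by (intro eq_vecI) (auto simp: example_B_def unit_vec_def)
  then have cols: "cols (example_B n q i) = map (unit_vec n) [0..<Suc q]"
    by (auto simp: cols_def example_B_def)
  show ?thesis
  proof (rule lin_indpt_full_rank)
    show "distinct (cols (example_B n q i))"
      unfolding cols distinct_map using assms by (auto simp: inj_on_def)
    show "lin_indpt (set (cols (example_B n q i)))"
      using unit_vecs_basis assms unfolding cols basis_def
      by (elim conjE subset_li_is_li) (auto simp: unit_vecs_def)
  qed (simp add: example_B_def)
qed

lemma ranked_switched_system_example: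
  assumes ql: "Suc (q + l) < n" and m: "l < m"
  shows "ranked_switched_system n m (example_A n q l) (example_B n q) (Suc q)"
proof -
  interpret switched_system n m "example_A n q l" "example_B n q"
    using perm_mat_invertible[OF example_perm_permutes[OF ql]]
    by unfold_locales (auto simp: example_A_def example_B_def)
  show ?thesis
  proof
    fix X assume X: "invariant X" "\<And>i. i < m \<Longrightarrow> input_range i \<subseteq> X"
    have sub: "submodule class_ring X V" using X by (simp add: invariant_def)
    have base: "unit_vec n x \<in> X" if "x < Suc q" for x
    proof -
      have "example_B n q 0 *\<^sub>v unit_vec (Suc q) x \<in> input_range 0"
        unfolding input_range_def by (intro CollectI exI[of _ "unit_vec (Suc q) x"]) simp
      moreover have "example_B n q 0 *\<^sub>v unit_vec (Suc q) x = unit_vec n x"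
        using ql that by (intro eq_vecI) (auto simp: example_B_def)
      ultimately show ?thesis using X(2)[of 0] m by auto
    qed
    have "unit_vec n x \<in> X" if "x < n" for x
      using that
    proof (induction x)
      case 0
      show ?case by (rule base) simp
    next
      case (Suc x)
      show ?case
      proof (cases "Suc x < Suc q")
        case True
        then show ?thesis by (rule base)
      next
        case False
        \<comment> \<open>This mode moves coordinate \<open>x\<close> to \<open>Suc x\<close>: by a
          transposition while \<open>x < q + l\<close>, by the cycle afterwards.\<close>
        let ?i = "min (x - q) l"
        have "example_A n q l ?i *\<^sub>v unit_vec n x \<in> X"
          using X(1) Suc m by (auto simp: invariant_def)
        moreover have "example_perm n q l ?i x = Suc x"
          using False Suc.prems by (auto simp: example_perm_def cycle_from_def min_def)
        ultimately show ?thesis using Suc.prems by (simp add: example_A_def perm_mat_unit_vec)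
      qed
    qed
    then have "span (set (unit_vecs n)) \<subseteq> X"
      by (intro span_is_subset sub) (auto simp: unit_vecs_def)
    then show "X = carrier_vec n"
      using submodule_vecD(1)[OF sub] span_unit_vecs_is_carrier by auto
  qed (use ql m rank_example_B[of q n] in auto)
qed

text \<open>The example with \<open>l = k - 1\<close> uses \<open>k\<close> different modes; the
  remaining \<open>m - k\<close> repeat the cycle.\<close>

lemma exists_slow_system:
  assumes "r < n" "1 \<le> r" "1 \<le> k" "k \<le> n - r" "k \<le> m"
  obtains A B where "admissible n m (\<lambda>j. j = r) A B" "controllable_sys n m A B"
    "n - r + 1 + k * (k - 1) div 2 \<le> min_ctrl_len n m A B"
proof -
  define q l where "q = r - 1" and "l = k - 1"
  have r: "r = Suc q" and k: "k = Suc l" using assms by (auto simp: q_def l_def)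
  have ql: "Suc (q + l) < n" using assms unfolding r k by simp
  let ?A = "example_A n q l" and ?B = "example_B n q"
  interpret ranked_switched_system n m ?A ?B "Suc q"
    using assms k by (intro ranked_switched_system_example[OF ql]) simp
  obtain \<pi> where \<pi>: "word \<pi>" "controllable_seq n ?A ?B \<pi>"
    using short_controllable_seq by auto
  show thesis
  proof (rule that)
    show "admissible n m (\<lambda>j. j = r) ?A ?B"
      using A_carrier A_invertible dim_row_B rank_example_B[of q n] ql
      by (auto simp: admissible_def r)
    show "controllable_sys n m ?A ?B"
      unfolding controllable_sys_def
    proof
      show "(\<Union>\<pi>\<in>{\<pi>. word \<pi>}. R \<pi>) \<subseteq> carrier_vec n" using reach_carrier by auto
      show "carrier_vec n \<subseteq> (\<Union>\<pi>\<in>{\<pi>. word \<pi>}. R \<pi>)"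
        using UN_upper[of \<pi> "{\<pi>. word \<pi>}" R] \<pi> by (simp add: controllable_seq_def)
    qed
    \<comment> \<open>The \<open>LEAST\<close> in \<open>min_ctrl_len\<close> is attained only if
      some word is controllable; the upper bound provides one.\<close>
    have "\<exists>k \<pi>'. word \<pi>' \<and> length \<pi>' = k \<and> controllable_seq n ?A ?B \<pi>'"
      using \<pi> by blast
    from LeastI_ex[OF this] obtain \<pi>' where "length \<pi>' = min_ctrl_len n m ?A ?B"
      "controllable_seq n ?A ?B \<pi>'"
      unfolding min_ctrl_len_def by blast
    then show "n - r + 1 + k * (k - 1) div 2 \<le> min_ctrl_len n m ?A ?B"
      using example_controllable_length[OF ql, of \<pi>'] unfolding r k by simp
  qed
qed

section \<open>Bounds for the maximal lengths\<close>

lemma min_ctrl_len_le: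
  assumes "r \<le> n" "1 \<le> m" and adm: "admissible n m (\<lambda>k. r \<le> k) A B"
    and ctrl: "controllable_sys n m A B"
  shows "min_ctrl_len n m A B \<le> (n - r + 1) * (n - r) div 2 + 1"
proof -
  interpret switched_system n m A B
    using adm by unfold_locales (auto simp: admissible_def)
  interpret ranked_switched_system n m A B r
    using assms invariant_full_of_controllable_sys[OF ctrl]
    by unfold_locales (auto simp: admissible_def)
  obtain \<pi> where \<pi>: "word \<pi>" "controllable_seq n A B \<pi>"
    "length \<pi> \<le> (n - r + 1) * (n - r) div 2 + 1"
    using short_controllable_seq by blast
  have "min_ctrl_len n m A B \<le> length \<pi>"
    unfolding min_ctrl_len_def by (rule Least_le) (use \<pi> in blast)
  then show ?thesis using \<pi> by simp
qed

lemma calB_le_calBbar: "calB n r m \<le> calBbar n r m"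
  unfolding calB_def calBbar_def by (rule SUP_subset_mono) (auto simp: admissible_def)

lemma calBbar_le:
  assumes "r \<le> n" "1 \<le> m"
  shows "calBbar n r m \<le> enat ((n - r + 1) * (n - r) div 2 + 1)"
  unfolding calBbar_def using min_ctrl_len_le[OF assms] by (intro SUP_least) auto

text \<open>The parameter \<open>k\<close> is taken as \<open>m\<close> for few modes, and as
  \<open>n - r\<close> when \<open>m\<close> is at least \<open>n - r\<close>.\<close>

lemma calB_ge:
  assumes "r < n" "1 \<le> r" "1 \<le> k" "k \<le> n - r" "k \<le> m"
  shows "enat (n - r + 1 + k * (k - 1) div 2) \<le> calB n r m"
proof -
  obtain A B where AB: "admissible n m (\<lambda>j. j = r) A B" "controllable_sys n m A B"
    "n - r + 1 + k * (k - 1) div 2 \<le> min_ctrl_len n m A B"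
    by (rule exists_slow_system[OF assms])
  have "enat (min_ctrl_len n m A B) \<le> calB n r m"
    unfolding calB_def by (rule SUP_upper2[of "(A, B)"]) (use AB in auto)
  then show ?thesis using AB(3) by (meson enat_ord_simps(1) order_trans)
qed

theorem theorem3:
  fixes n r m :: nat
  assumes "n \<ge> 2" and "m \<ge> 1" and "1 \<le> r" and "r < n"
  shows "calB n r m \<le> calBbar n r m \<and>
         calBbar n r m \<le> enat ((n - r + 1) * (n - r) div 2 + 1) \<and>
         (m \<le> n - r \<longrightarrow> enat (n - r + 1 + m * (m - 1) div 2) \<le> calB n r m) \<and>
         (m \<ge> n - r \<longrightarrow> calB n r m = enat ((n - r + 1) * (n - r) div 2 + 1) \<and>
                          calBbar n r m = enat ((n - r + 1) * (n - r) div 2 + 1))"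
proof (intro conjI impI)
  show le: "calB n r m \<le> calBbar n r m" by (rule calB_le_calBbar)
  show ub: "calBbar n r m \<le> enat ((n - r + 1) * (n - r) div 2 + 1)"
    using assms by (intro calBbar_le) auto
  show "enat (n - r + 1 + m * (m - 1) div 2) \<le> calB n r m" if "m \<le> n - r"
    using assms that by (intro calB_ge) auto
  assume m: "n - r \<le> m"
  obtain s where s: "n - r = Suc s" using assms by (metis Suc_diff_Suc)
  \<comment> \<open>The upper bound equals the lower bound for \<open>k = n - r\<close>; writing
    \<open>n - r\<close> as \<open>Suc s\<close> removes the truncated subtraction.\<close>
  have eq: "(n - r + 1) * (n - r) div 2 + 1 = n - r + 1 + (n - r) * (n - r - 1) div 2"
    unfolding s by simp
  have lb: "enat ((n - r + 1) * (n - r) div 2 + 1) \<le> calB n r m"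
    unfolding eq using assms m by (intro calB_ge) auto
  show "calB n r m = enat ((n - r + 1) * (n - r) div 2 + 1)"
    using lb le ub by (meson order_antisym order_trans)
  show "calBbar n r m = enat ((n - r + 1) * (n - r) div 2 + 1)"
    using lb le ub by (meson order_antisym order_trans)
qed

end
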